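(* For all natural numbers $n,d>1$ and every integer $r$ with $0\le r<d$, there exists a sentence $\theta$ of ${\cal R}ing(0,+,* )+MOD(d)$ such that $Sp(\theta)=^*\{p\text{ prime}: p\equiv rn+1 \pmod{nd}\}$.
   Context: For an integer $m\ge1$, $\mathbb{Z}_m$ is the finite residue class ring with universe $\{0,\ldots,m-1\}$ and addition and multiplication mod $m$. ${\cal R}ing(0,+,* )$ is the set of first-order formulas over a constant symbol $0$ and binary function symbols $+,*$, interpreted in $\mathbb{Z}_m$ as the residue class $0$ and addition and multiplication mod $m$. ${\cal R}ing(0,+,* )+MOD(d)$ extends it with modular quantifiers $\exists^{(r,d)}z$ ($0\le r<d$), where $\mathbb{Z}_m\models\exists^{(r,d)}z\,\phi(\bar a,z)$ iff the number of $z\in\mathbb{Z}_m$ satisfying $\phi(\bar a,z)$ is congruent to $r$ modulo $d$. The prime spectrum of a sentence $\sigma$ is $Sp(\sigma)=\{p\text{ prime}:\mathbb{Z}_p\models\sigma\}$. For sets $A,B$ of primes, $A=^*B$ means their symmetric difference is finite. *)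

theory Defs
  imports "HOL-Number_Theory.Number_Theory"
begin

datatype ring_term =
    TVar nat
  | TZero
  | TAdd ring_term ring_term
  | TMul ring_term ring_term

text \<open>
  First-order formulas over the symbols 0, +, * with equality, extended with modular
  quantifiers: \<open>FModEx r d x \<phi>\<close> stands for the formula binding \<open>x\<close> which says that the number of
  witnesses for \<open>x\<close> in \<open>\<phi>\<close> is congruent to \<open>r\<close> modulo \<open>d\<close>. Variables are named by natural
  numbers. The datatype allows arbitrary \<open>r\<close> and \<open>d\<close>; the set \<open>ring_MOD d\<close> below cuts out
  the formulas in which all modular quantifiers have the fixed modulus \<open>d\<close> and a residue
  less than \<open>d\<close>.
\<close>

datatype ring_formula =
    FEq ring_term ring_term
  | FNot ring_formula
  | FAnd ring_formula ring_formula
  | FOr ring_formula ring_formula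
  | FImp ring_formula ring_formula
  | FAll nat ring_formula
  | FEx nat ring_formula
  | FModEx nat nat nat ring_formula

inductive_set ring_MOD :: "nat \<Rightarrow> ring_formula set" for d :: nat where
  "FEq t u \<in> ring_MOD d"
| "\<phi> \<in> ring_MOD d \<Longrightarrow> FNot \<phi> \<in> ring_MOD d"
| "\<phi> \<in> ring_MOD d \<Longrightarrow> \<psi> \<in> ring_MOD d \<Longrightarrow> FAnd \<phi> \<psi> \<in> ring_MOD d"
| "\<phi> \<in> ring_MOD d \<Longrightarrow> \<psi> \<in> ring_MOD d \<Longrightarrow> FOr \<phi> \<psi> \<in> ring_MOD d"
| "\<phi> \<in> ring_MOD d \<Longrightarrow> \<psi> \<in> ring_MOD d \<Longrightarrow> FImp \<phi> \<psi> \<in> ring_MOD d"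
| "\<phi> \<in> ring_MOD d \<Longrightarrow> FAll x \<phi> \<in> ring_MOD d"
| "\<phi> \<in> ring_MOD d \<Longrightarrow> FEx x \<phi> \<in> ring_MOD d"
| "\<phi> \<in> ring_MOD d \<Longrightarrow> r < d \<Longrightarrow> FModEx r d x \<phi> \<in> ring_MOD d"

primrec term_vars :: "ring_term \<Rightarrow> nat set" where
  "term_vars (TVar x) = {x}"
| "term_vars TZero = {}"
| "term_vars (TAdd t u) = term_vars t \<union> term_vars u"
| "term_vars (TMul t u) = term_vars t \<union> term_vars u"

primrec free_vars :: "ring_formula \<Rightarrow> nat set" where
  "free_vars (FEq t u) = term_vars t \<union> term_vars u"
| "free_vars (FNot \<phi>) = free_vars \<phi>"
| "free_vars (FAnd \<phi> \<psi>) = free_vars \<phi> \<union> free_vars \<psi>"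
| "free_vars (FOr \<phi> \<psi>) = free_vars \<phi> \<union> free_vars \<psi>"
| "free_vars (FImp \<phi> \<psi>) = free_vars \<phi> \<union> free_vars \<psi>"
| "free_vars (FAll x \<phi>) = free_vars \<phi> - {x}"
| "free_vars (FEx x \<phi>) = free_vars \<phi> - {x}"
| "free_vars (FModEx r d x \<phi>) = free_vars \<phi> - {x}"

definition ring_MOD_sentences :: "nat \<Rightarrow> ring_formula set" where
  "ring_MOD_sentences d = {\<phi> \<in> ring_MOD d. free_vars \<phi> = {}}"

primrec term_val :: "('a, 'b) ring_scheme \<Rightarrow> (nat \<Rightarrow> 'a) \<Rightarrow> ring_term \<Rightarrow> 'a" where
  "term_val R s (TVar x) = s x"
| "term_val R s TZero = \<zero>\<^bsub>R\<^esub>"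
| "term_val R s (TAdd t u) = term_val R s t \<oplus>\<^bsub>R\<^esub> term_val R s u"
| "term_val R s (TMul t u) = term_val R s t \<otimes>\<^bsub>R\<^esub> term_val R s u"

text \<open>
  The clause for \<open>FModEx\<close> is intended for rings with finite carrier only, as \<open>card\<close> is 0 on
  infinite sets.
\<close>

primrec sat :: "('a, 'b) ring_scheme \<Rightarrow> (nat \<Rightarrow> 'a) \<Rightarrow> ring_formula \<Rightarrow> bool" where
  "sat R s (FEq t u) \<longleftrightarrow> term_val R s t = term_val R s u"
| "sat R s (FNot \<phi>) \<longleftrightarrow> \<not> sat R s \<phi>"
| "sat R s (FAnd \<phi> \<psi>) \<longleftrightarrow> sat R s \<phi> \<and> sat R s \<psi>"
| "sat R s (FOr \<phi> \<psi>) \<longleftrightarrow> sat R s \<phi> \<or> sat R s \<psi>"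
| "sat R s (FImp \<phi> \<psi>) \<longleftrightarrow> (sat R s \<phi> \<longrightarrow> sat R s \<psi>)"
| "sat R s (FAll x \<phi>) \<longleftrightarrow> (\<forall>a \<in> carrier R. sat R (s(x := a)) \<phi>)"
| "sat R s (FEx x \<phi>) \<longleftrightarrow> (\<exists>a \<in> carrier R. sat R (s(x := a)) \<phi>)"
| "sat R s (FModEx r d x \<phi>) \<longleftrightarrow>
     [card {a \<in> carrier R. sat R (s(x := a)) \<phi>} = r] (mod d)"

definition models :: "('a, 'b) ring_scheme \<Rightarrow> ring_formula \<Rightarrow> bool" where
  "models R \<phi> \<longleftrightarrow> (\<forall>s. (\<forall>x. s x \<in> carrier R) \<longrightarrow> sat R s \<phi>)"

definition prime_spectrum :: "ring_formula \<Rightarrow> nat set" where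
  "prime_spectrum \<sigma> = {p. prime p \<and> models (residue_ring (int p)) \<sigma>}"

definition almost_eq :: "'a set \<Rightarrow> 'a set \<Rightarrow> bool"  (infix "=\<^sup>*" 50) where
  "A =\<^sup>* B \<longleftrightarrow> finite (sym_diff A B)"

end

(* The numbers p with p = r n + 1 modulo n d are those for which n divides p - 1 and
   (p - 1) div n = r modulo d.  For a prime p, the first condition says that the multiplicative
   group of Z_p, being cyclic, has an element of order n, which is a first-order property.  Under
   this condition the nonzero n-th powers form the subgroup of index n, so the second condition
   says that the number of nonzero n-th powers is congruent to r modulo d. *)
theory Submission
  imports Defs
begin

text \<open>Exactly \<open>totient n\<close> elements have order \<open>n\<close> if
  \<open>n\<close> divides \<open>p - 1\<close>, and none otherwise; \<open>totient n\<close> is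
  positive. Residues of positive order are coprime to \<open>p\<close>, so restricting to totatives
  loses nothing.\<close>

lemma prime_ord_exists_iff:
  fixes p n :: nat
  assumes "prime p" "n > 0"
  shows "(\<exists>x<p. ord p x = n) \<longleftrightarrow> n dvd p - 1"
proof -
  have "card {x\<in>totatives p. ord p x = n} = (if n dvd p - 1 then totient n else 0)"
    using prime_card_elements_with_ord_eq_totient[OF prime_gt_1_nat assms(1)] assms(1) by simp
  moreover have "{x\<in>{..<p}. ord p x = n} = {x\<in>totatives p. ord p x = n}"
    using elements_with_ord_restrict_totatives[of p n] assms prime_gt_1_nat by blast
  ultimately have "card {x\<in>{..<p}. ord p x = n} > 0 \<longleftrightarrow> n dvd p - 1"
    using assms by auto
  moreover have "card {x\<in>{..<p}. ord p x = n} > 0 \<longleftrightarrow> (\<exists>x<p. ord p x = n)"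
    by (auto simp: card_gt_0_iff)
  ultimately show ?thesis by simp
qed

text \<open>This rewrites the order as finitely many conditions on fixed powers, which a first-order
  formula can express.\<close>

lemma ord_eq_iff:
  fixes p x n :: nat
  assumes "n > 0"
  shows "ord p x = n \<longleftrightarrow> [x ^ n = 1] (mod p) \<and> (\<forall>k\<in>{1..<n}. \<not> [x ^ k = 1] (mod p))"
proof
  assume "ord p x = n"
  then show "[x ^ n = 1] (mod p) \<and> (\<forall>k\<in>{1..<n}. \<not> [x ^ k = 1] (mod p))"
    using ord_works[of x p] by auto
next
  assume *: "[x ^ n = 1] (mod p) \<and> (\<forall>k\<in>{1..<n}. \<not> [x ^ k = 1] (mod p))"
  then have dvd: "ord p x dvd n"
    by (simp only: ord_divides)
  then have "ord p x \<le> n" "ord p x > 0"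
    using assms by (auto intro: dvd_imp_le gr0I)
  \<comment> \<open>Otherwise \<open>ord p x\<close> itself would be one of the excluded exponents
    \<open>k\<close>.\<close>
  moreover have "\<not> ord p x < n"
    using * ord[of x p] \<open>ord p x > 0\<close>
    by (metis One_nat_def Suc_leI atLeastLessThan_iff)
  ultimately show "ord p x = n" by simp
qed

text \<open>A nonzero residue is \<open>g ^ k\<close>, and its \<open>n\<close>-th power
  \<open>g ^ (n * k)\<close> depends on \<open>n * k\<close> only modulo the order
  \<open>n * m\<close> of \<open>g\<close>, hence on \<open>k\<close> only modulo
  \<open>m\<close>.\<close>

lemma prime_nth_powers_eq:
  fixes p n m g :: nat
  assumes p: "prime p" and m: "p - 1 = n * m" and g: "residue_primroot p g"
  shows "{x. x < p \<and> x \<noteq> 0 \<and> (\<exists>y<p. x = y ^ n mod p)} = (\<lambda>j. g ^ (n * j) mod p) ` {..<m}"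
proof -
  have p1: "p > 1" and nm: "n > 0" "m > 0"
    using prime_gt_1_nat[OF p] m by (auto intro!: gr0I)
  have cop: "coprime p g" and ordg: "ord p g = n * m"
    using g p m by (auto simp: residue_primroot_def totient_prime)
  have gen: "(\<lambda>k. g ^ k mod p) ` {..<n * m} = {0<..<p}"
    using residue_primroot_is_generator[OF p1 g] p m
    by (simp add: bij_betw_def totient_prime totatives_prime)
  show ?thesis
  proof (intro equalityI subsetI)
    fix x assume "x \<in> {x. x < p \<and> x \<noteq> 0 \<and> (\<exists>y<p. x = y ^ n mod p)}"
    then obtain y where x: "x \<noteq> 0" "x = y ^ n mod p" and "y < p" by auto
    have "y \<noteq> 0" using x nm by (auto intro!: gr0I simp: power_0_left)
    with \<open>y < p\<close> gen obtain k where y: "y = g ^ k mod p"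
      by (metis (no_types, lifting) greaterThanLessThan_iff imageE neq0_conv)
    have "[n * k = n * (k mod m)] (mod n * m)"
      by (simp add: cong_def)
    then have "[g ^ (n * k) = g ^ (n * (k mod m))] (mod p)"
      using order_divides_expdiff[OF cop] ordg by simp
    moreover have "x = g ^ (n * k) mod p"
      using x y by (simp add: power_mod mult.commute flip: power_mult)
    ultimately have "x = g ^ (n * (k mod m)) mod p" by (simp add: cong_def)
    then show "x \<in> (\<lambda>j. g ^ (n * j) mod p) ` {..<m}" using nm by auto
  next
    fix x assume "x \<in> (\<lambda>j. g ^ (n * j) mod p) ` {..<m}"
    then obtain j where x: "x = g ^ (n * j) mod p" by auto
    have "coprime p (g ^ (n * j))" using cop by simp
    then have "x \<noteq> 0"
      using x p1 by (metis coprime_absorb_left mod_0_imp_dvd nat_neq_iff not_prime_unit p)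
    moreover have "x = (g ^ j mod p) ^ n mod p"
      using x by (simp add: power_mod mult.commute flip: power_mult)
    ultimately show "x \<in> {x. x < p \<and> x \<noteq> 0 \<and> (\<exists>y<p. x = y ^ n mod p)}"
      using p1 x by (auto intro!: exI[of _ "g ^ j mod p"])
  qed
qed

text \<open>The exponents \<open>n * j\<close> with \<open>j < m\<close> are pairwise incongruent
  modulo the order \<open>n * m\<close> of a primitive root, so the parametrization of the powers by
  \<open>j\<close> is injective.\<close>

lemma card_prime_nth_powers:
  fixes p n :: nat
  assumes p: "prime p" and "n dvd p - 1"
  shows "card {x. x < p \<and> x \<noteq> 0 \<and> (\<exists>y<p. x = y ^ n mod p)} = (p - 1) div n"
proof -
  obtain m where m: "p - 1 = n * m" using assms by (elim dvdE)
  have n: "n > 0" using m prime_gt_1_nat[OF p] by (auto intro!: gr0I)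
  obtain g where g: "residue_primroot p g"
    using prime_primitive_root_exists[OF prime_gt_1_nat p] p by auto
  have "coprime p g" "ord p g = n * m"
    using g p m by (auto simp: residue_primroot_def totient_prime)
  then have "inj_on (\<lambda>j. g ^ (n * j) mod p) {..<m}"
    using order_divides_expdiff[of p g] n
    by (auto intro!: inj_onI simp: cong_def)
  then show ?thesis
    unfolding prime_nth_powers_eq[OF p m g] using m n by (simp add: card_image)
qed

text \<open>Cancel the summand 1, then the factor \<open>n\<close>. Positivity of \<open>p\<close>
  makes the truncated \<open>p - 1\<close> a true predecessor.\<close>

lemma cong_mult_Suc_iff:
  fixes p n d r :: nat
  assumes "n > 0" "p > 0"
  shows "[p = r * n + 1] (mod (n * d)) \<longleftrightarrow> n dvd p - 1 \<and> [(p - 1) div n = r] (mod d)"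
proof -
  have "[p = r * n + 1] (mod (n * d)) \<longleftrightarrow> [(p - 1) + 1 = r * n + 1] (mod (n * d))"
    using assms by simp
  also have "\<dots> \<longleftrightarrow> [p - 1 = n * r] (mod (n * d))"
    by (simp only: cong_add_rcancel_nat mult.commute)
  also have "\<dots> \<longleftrightarrow> n dvd p - 1 \<and> [(p - 1) div n = r] (mod d)"
  proof
    assume *: "[p - 1 = n * r] (mod (n * d))"
    then have "[p - 1 = n * r] (mod n)" by (rule cong_modulus_mult_nat)
    then have "n dvd p - 1" by (simp add: cong_def mod_eq_0_iff_dvd)
    with * show "n dvd p - 1 \<and> [(p - 1) div n = r] (mod d)"
      using assms by (auto elim!: dvdE simp: cong_def)
  next
    assume "n dvd p - 1 \<and> [(p - 1) div n = r] (mod d)"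
    then show "[p - 1 = n * r] (mod (n * d))"
      using assms by (auto elim!: dvdE simp: cong_def)
  qed
  finally show ?thesis .
qed

text \<open>The language has no symbol for 1, so the exponent 0 is treated like 1.\<close>

definition term_power :: "ring_term \<Rightarrow> nat \<Rightarrow> ring_term" where
  "term_power t k = (TMul t ^^ (k - 1)) t"

lemma term_vars_term_power [simp]: "term_vars (term_power t k) = term_vars t"
proof -
  have "term_vars ((TMul t ^^ j) t) = term_vars t" for j by (induction j) auto
  then show ?thesis by (simp add: term_power_def)
qed

text \<open>For \<open>k = 1\<close> no multiplication reduces the value, so the value of
  \<open>t\<close> must already be a reduced residue.\<close>

lemma term_val_term_power:
  assumes "k > 0" "term_val (residue_ring m) s t \<in> {0..m - 1}"
  shows "term_val (residue_ring m) s (term_power t k) = term_val (residue_ring m) s t ^ k mod m"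
proof -
  have "term_val (residue_ring m) s ((TMul t ^^ j) t) = term_val (residue_ring m) s t ^ Suc j mod m" for j
    using assms by (induction j) (auto simp: residue_ring_def mod_simps)
  from this[of "k - 1"] show ?thesis using assms by (simp add: term_power_def)
qed

text \<open>The closed equation 0 = 0 stands in for truth as the empty conjunction.\<close>

definition FConj :: "ring_formula list \<Rightarrow> ring_formula" where
  "FConj \<phi>s = foldr FAnd \<phi>s (FEq TZero TZero)"

lemma FConj_in_ring_MOD: "(\<And>\<phi>. \<phi> \<in> set \<phi>s \<Longrightarrow> \<phi> \<in> ring_MOD d) \<Longrightarrow> FConj \<phi>s \<in> ring_MOD d"
  unfolding FConj_def by (induction \<phi>s) (auto intro: ring_MOD.intros)

lemma free_vars_FConj [simp]: "free_vars (FConj \<phi>s) = (\<Union>\<phi>\<in>set \<phi>s. free_vars \<phi>)"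
  unfolding FConj_def by (induction \<phi>s) auto

lemma sat_FConj [simp]: "sat R s (FConj \<phi>s) \<longleftrightarrow> (\<forall>\<phi>\<in>set \<phi>s. sat R s \<phi>)"
  unfolding FConj_def by (induction \<phi>s) auto

text \<open>The variable 1 is forced to be the unit element, as a nonzero idempotent.\<close>

definition FElementOfOrder :: "nat \<Rightarrow> ring_formula" where
  "FElementOfOrder n =
     FEx 1 (FAnd (FAnd (FNot (FEq (TVar 1) TZero)) (FEq (TMul (TVar 1) (TVar 1)) (TVar 1)))
       (FEx 0 (FAnd (FEq (term_power (TVar 0) n) (TVar 1))
         (FConj (map (\<lambda>k. FNot (FEq (term_power (TVar 0) k) (TVar 1))) [1..<n])))))"

text \<open>The root is bound existentially inside the count, so that each power counts once and not
  once per root. Variable 1 is an arbitrary root here, not the unit element.\<close>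

definition FCountPowers :: "nat \<Rightarrow> nat \<Rightarrow> nat \<Rightarrow> ring_formula" where
  "FCountPowers n d r =
     FModEx r d 0 (FAnd (FNot (FEq (TVar 0) TZero)) (FEx 1 (FEq (TVar 0) (term_power (TVar 1) n))))"

lemma FElementOfOrder_in_sentences: "FElementOfOrder n \<in> ring_MOD_sentences d"
  by (auto simp: FElementOfOrder_def ring_MOD_sentences_def
      intro!: ring_MOD.intros FConj_in_ring_MOD)

lemma FCountPowers_in_sentences: "r < d \<Longrightarrow> FCountPowers n d r \<in> ring_MOD_sentences d"
  by (auto simp: FCountPowers_def ring_MOD_sentences_def intro!: ring_MOD.intros)

text \<open>The residue ring consists of integers, whereas orders and primitive roots are treated
  over the naturals; this is the bridge.\<close>

lemma carrier_residue_ring_eq: "carrier (residue_ring (int p)) = int ` {..<p}"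
  by (auto simp: residue_ring_def image_iff intro!: bexI[of _ "nat _"])

lemma residue_ring_sel:
  "zero (residue_ring m) = 0" "mult (residue_ring m) x y = x * y mod m"
  by (simp_all add: residue_ring_def)

lemma term_val_power_var:
  assumes "k > 0" "s x = int a" "a < p"
  shows "term_val (residue_ring (int p)) s (term_power (TVar x) k) = int (a ^ k mod p)"
  using term_val_term_power[of k "int p" s "TVar x"] assms by (simp add: zmod_int)

text \<open>A nonzero \<open>e < p\<close> is coprime to \<open>p\<close>, so it cancels from
  \<open>e * e = e * 1\<close>.\<close>

lemma prime_idempotent_iff:
  fixes p e :: nat
  assumes "prime p" "e < p"
  shows "e \<noteq> 0 \<and> e * e mod p = e \<longleftrightarrow> e = 1"
proof
  assume *: "e \<noteq> 0 \<and> e * e mod p = e"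
  then have "[e * e = e * 1] (mod p)" using assms by (simp add: cong_def)
  moreover have "coprime e p"
    using * assms by (metis coprime_commute prime_imp_coprime nat_dvd_not_less neq0_conv)
  ultimately have "[e = 1] (mod p)" by (simp only: cong_mult_lcancel_nat)
  then show "e = 1" using assms prime_gt_1_nat[OF assms(1)] by (simp add: cong_def)
qed (use prime_gt_1_nat[OF assms(1)] in auto)

lemma sat_FElementOfOrder:
  assumes p: "prime p" and n: "n > 0"
  shows "sat (residue_ring (int p)) s (FElementOfOrder n) \<longleftrightarrow> n dvd p - 1"
proof -
  have "sat (residue_ring (int p)) s (FElementOfOrder n) \<longleftrightarrow>
      (\<exists>e<p. (e \<noteq> 0 \<and> e * e mod p = e) \<and>
        (\<exists>x<p. x ^ n mod p = e \<and> (\<forall>k\<in>{1..<n}. x ^ k mod p \<noteq> e)))"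
    using n unfolding FElementOfOrder_def
    by (simp add: carrier_residue_ring_eq term_val_power_var
        residue_ring_sel flip: of_nat_mult of_nat_mod cong: conj_cong) (simp add: Bex_def)
  also have "\<dots> \<longleftrightarrow> (\<exists>e<p. e = 1 \<and> (\<exists>x<p. x ^ n mod p = e \<and> (\<forall>k\<in>{1..<n}. x ^ k mod p \<noteq> e)))"
    using prime_idempotent_iff[OF p] by (simp cong: conj_cong)
  \<comment> \<open>Since \<open>1 < p\<close>, the residue of 1 is 1, so equality with
    \<open>e = 1\<close> is congruence to 1.\<close>
  also have "\<dots> \<longleftrightarrow> (\<exists>x<p. ord p x = n)"
    using prime_gt_1_nat[OF p] n by (simp add: ord_eq_iff cong_def)
  also have "\<dots> \<longleftrightarrow> n dvd p - 1" using assms by (rule prime_ord_exists_iff)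
  finally show ?thesis .
qed

text \<open>The count is known only when \<open>n\<close> divides \<open>p - 1\<close>; in the final
  sentence the first conjunct guarantees this.\<close>

lemma sat_FCountPowers:
  assumes p: "prime p" and n: "n dvd p - 1"
  shows "sat (residue_ring (int p)) s (FCountPowers n d r) \<longleftrightarrow> [(p - 1) div n = r] (mod d)"
proof -
  have "n > 0" using n prime_gt_1_nat[OF p] by (auto intro!: gr0I)
  then have "{a \<in> carrier (residue_ring (int p)). sat (residue_ring (int p)) (s(0 := a))
        (FAnd (FNot (FEq (TVar 0) TZero)) (FEx 1 (FEq (TVar 0) (term_power (TVar 1) n))))} =
      int ` {x. x < p \<and> x \<noteq> 0 \<and> (\<exists>y<p. x = y ^ n mod p)}"
    by (auto simp: carrier_residue_ring_eq term_val_power_var residue_ring_sel)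
  then show ?thesis
    by (simp only: FCountPowers_def sat.simps card_image[OF inj_on_of_nat]
        card_prime_nth_powers[OF assms])
qed

theorem theorem5p11:
  fixes n d r :: nat
  assumes "n > 1" and "d > 1" and "r < d"
  shows "\<exists>\<theta> \<in> ring_MOD_sentences d.
           prime_spectrum \<theta> =\<^sup>* {p. prime p \<and> [p = r * n + 1] (mod (n * d))}"
proof (rule bexI)
  let ?\<theta> = "FAnd (FElementOfOrder n) (FCountPowers n d r)"
  show "?\<theta> \<in> ring_MOD_sentences d"
    using FElementOfOrder_in_sentences[of n d] FCountPowers_in_sentences[OF assms(3), of n]
    by (auto simp: ring_MOD_sentences_def intro: ring_MOD.intros)
  have "models (residue_ring (int p)) ?\<theta> \<longleftrightarrow> [p = r * n + 1] (mod (n * d))" if "prime p" for p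
  proof -
    have "sat (residue_ring (int p)) s ?\<theta> \<longleftrightarrow> [p = r * n + 1] (mod (n * d))" for s
      using that assms sat_FElementOfOrder[of p n s] sat_FCountPowers[of p n s d r]
        cong_mult_Suc_iff[of n p r d] prime_gt_0_nat[of p] by auto
    \<comment> \<open>\<open>models\<close> quantifies over all assignments into the carrier; one
      must exist for it not to hold vacuously.\<close>
    moreover have "\<exists>s::nat \<Rightarrow> int. \<forall>x. s x \<in> carrier (residue_ring (int p))"
      using prime_gt_0_nat[OF that] by (auto simp: carrier_residue_ring_eq intro!: exI[of _ "\<lambda>_. 0"])
    ultimately show ?thesis unfolding models_def by blast
  qed
  then have "prime_spectrum ?\<theta> = {p. prime p \<and> [p = r * n + 1] (mod (n * d))}"
    by (auto simp: prime_spectrum_def)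
  \<comment> \<open>The two sets coincide, so their symmetric difference is even empty.\<close>
  then show "prime_spectrum ?\<theta> =\<^sup>* {p. prime p \<and> [p = r * n + 1] (mod (n * d))}"
    by (simp add: almost_eq_def)
qed

end
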